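(* Let $X$ be a finite nonempty ultrametric space with the representing tree $(T_X,l_X)$. The space $X$ is homogeneous if and only if the following two conditions hold. (i) For all different $x,y\in V(T_X)$ with $\operatorname{lev}(x)=\operatorname{lev}(y)$ the equality $l_X(x)=l_X(y)$ holds. (ii) For all different $x,y\in V(T_X)$ with $\operatorname{lev}(x)=\operatorname{lev}(y)$ the equality $\delta^{+}(x)=\delta^{+}(y)$ holds.
   Context: A metric space $X$ is homogeneous if every isometry $f$ whose domain and range are finite subsets of $X$ extends to a surjective isometry of $X$ onto $X$. Representing tree: let $(X,d)$ be a finite nonempty ultrametric space. If $|X|\geq 2$, the diametrical graph of $X$ is the graph with vertex set $X$ in which $u,v$ are adjacent iff $d(u,v)=\operatorname{diam}X$, where $\operatorname{diam} X=\max\{d(x,y):x,y\in X\}$; it is always complete $k$-partite for some $k\geq 2$, with uniquely determined nonempty parts $X_1,\dots,X_k$. The representing tree $(T_X,l_X)$ is the rooted labeled tree whose nodes are subsets of $X$, defined recursively: if $|X|=1$, $T_X$ consists of the single node $X$ labeled $0$; if $|X|\geq 2$, the root $X$ is labeled $\operatorname{diam}X$, its children are the parts $X_1,\dots,X_k$ of the diametrical graph of $X$, each child $X_i$ is labeled $l_X(X_i)=\operatorname{diam}X_i$, and the construction is repeated for every $X_i$ with $|X_i|\geq2$. The leaves of $T_X$ are exactly the singletons $\{x\}$, $x\in X$ (labeled $0$); the other nodes are internal. For a node $v$ of a rooted tree, $\operatorname{lev}(v)$ is its level (distance from the root) and $\delta^+(v)$ is the number of its children. *)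

theory Defs
  imports
    "HOL-Analysis.Abstract_Metric_Spaces"
    "HOL-Library.Disjoint_Sets"
    "Graph_Theory.Graph_Theory"
begin

section \<open>Ultrametric and homogeneous spaces\<close>

locale Ultrametric_space = Metric_space +
  assumes ultrametric:
    "\<And>x y z. \<lbrakk>x \<in> M; y \<in> M; z \<in> M\<rbrakk> \<Longrightarrow> d x z \<le> max (d x y) (d y z)"

definition isometry_on :: "('a \<Rightarrow> 'a \<Rightarrow> real) \<Rightarrow> 'a set \<Rightarrow> ('a \<Rightarrow> 'a) \<Rightarrow> bool" where
  "isometry_on d A f \<longleftrightarrow> (\<forall>x\<in>A. \<forall>y\<in>A. d (f x) (f y) = d x y)"

text \<open>A partial map with domain \<open>A\<close> is a total function of which only the values on \<open>A\<close>
  matter; its range is \<open>f ` A\<close>.\<close>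

definition homogeneous_space :: "'a set \<Rightarrow> ('a \<Rightarrow> 'a \<Rightarrow> real) \<Rightarrow> bool" where
  "homogeneous_space X d \<longleftrightarrow>
     (\<forall>A f. finite A \<and> A \<subseteq> X \<and> f ` A \<subseteq> X \<and> isometry_on d A f \<longrightarrow>
        (\<exists>g. isometry_on d X g \<and> g ` X = X \<and> (\<forall>x\<in>A. g x = f x)))"


section \<open>The diametrical graph\<close>

definition diam :: "('a \<Rightarrow> 'a \<Rightarrow> real) \<Rightarrow> 'a set \<Rightarrow> real" where
  "diam d S = Max {d x y | x y. x \<in> S \<and> y \<in> S}"

text \<open>As usual in \<^theory>\<open>Graph_Theory.Digraph\<close>, an undirected graph is a symmetric digraph.\<close>

definition diametrical_graph :: "('a \<Rightarrow> 'a \<Rightarrow> real) \<Rightarrow> 'a set \<Rightarrow> 'a pair_pre_digraph" where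
  "diametrical_graph d S =
     \<lparr>pverts = S, parcs = {(u, v). u \<in> S \<and> v \<in> S \<and> d u v = diam d S}\<rparr>"

definition complete_multipartite :: "'a pair_pre_digraph \<Rightarrow> 'a set set \<Rightarrow> bool" where
  "complete_multipartite G P \<longleftrightarrow>
     partition_on (pverts G) P \<and> 2 \<le> card P \<and>
     parcs G = {(u, v). \<exists>A\<in>P. \<exists>B\<in>P. A \<noteq> B \<and> u \<in> A \<and> v \<in> B}"

text \<open>For a finite ultrametric space with at least two points, existence and uniqueness of
  the parts are shown in \<open>ex1_diametrical_parts\<close> below.\<close>

definition diametrical_parts :: "('a \<Rightarrow> 'a \<Rightarrow> real) \<Rightarrow> 'a set \<Rightarrow> 'a set set" where
  "diametrical_parts d S = (THE P. complete_multipartite (diametrical_graph d S) P)"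


section \<open>The representing tree\<close>

inductive_set representing_nodes :: "('a \<Rightarrow> 'a \<Rightarrow> real) \<Rightarrow> 'a set \<Rightarrow> 'a set set"
  for d X where
  root: "X \<in> representing_nodes d X"
| child: "\<lbrakk>S \<in> representing_nodes d X; 2 \<le> card S; C \<in> diametrical_parts d S\<rbrakk>
    \<Longrightarrow> C \<in> representing_nodes d X"

text \<open>The tree is rooted at \<open>X\<close>, with its arcs directed from a node to its children.\<close>

definition representing_tree :: "('a \<Rightarrow> 'a \<Rightarrow> real) \<Rightarrow> 'a set \<Rightarrow> 'a set pair_pre_digraph" where
  "representing_tree d X =
     \<lparr>pverts = representing_nodes d X,
      parcs = {(S, C). S \<in> representing_nodes d X \<and> 2 \<le> card S \<and> C \<in> diametrical_parts d S}\<rparr>"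

definition node_label :: "('a \<Rightarrow> 'a \<Rightarrow> real) \<Rightarrow> 'a set \<Rightarrow> real" where
  "node_label d S = (if card S = 1 then 0 else diam d S)"

text \<open>Distance from the root \<open>r\<close>, along arcs pointing away from the root.\<close>

definition level :: "'v pair_pre_digraph \<Rightarrow> 'v \<Rightarrow> 'v \<Rightarrow> nat" where
  "level T r v = (LEAST n. (r, v) \<in> parcs T ^^ n)"

definition num_children :: "'v pair_pre_digraph \<Rightarrow> 'v \<Rightarrow> nat" where
  "num_children T v = out_degree (with_proj T) v"


section \<open>Well-definedness\<close>

lemma complete_multipartite_part_eq:
  assumes "complete_multipartite G P" "A \<in> P" "u \<in> A"
  shows "A = {v \<in> pverts G. (u, v) \<notin> parcs G}"
proof -
  have po: "partition_on (pverts G) P"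
    and arcs: "parcs G = {(u, v). \<exists>A\<in>P. \<exists>B\<in>P. A \<noteq> B \<and> u \<in> A \<and> v \<in> B}"
    using assms(1) by (auto simp: complete_multipartite_def)
  have uniq: "B = C" if "B \<in> P" "C \<in> P" "w \<in> B" "w \<in> C" for B C w
    using po that unfolding partition_on_def disjoint_def by blast
  have cover: "\<Union>P = pverts G"
    using po by (auto simp: partition_on_def)
  show ?thesis
    unfolding arcs cover[symmetric] using assms(2,3) uniq by blast
qed

lemma complete_multipartite_unique:
  assumes "complete_multipartite G P" "complete_multipartite G Q"
  shows "P = Q"
proof -
  have "P \<subseteq> Q" if P: "complete_multipartite G P" and Q: "complete_multipartite G Q" for P Q
  proof
    fix A assume A: "A \<in> P"
    have "A \<noteq> {}" "A \<subseteq> pverts G" "\<Union>Q = pverts G"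
      using A P Q by (auto simp: complete_multipartite_def partition_on_def)
    then obtain u B where u: "u \<in> A" "B \<in> Q" "u \<in> B" by blast
    have "A = B"
      using complete_multipartite_part_eq[OF P A u(1)] complete_multipartite_part_eq[OF Q u(2,3)]
      by (rule trans[OF _ sym])
    with u(2) show "A \<in> Q" by simp
  qed
  with assms show ?thesis by blast
qed

context Ultrametric_space
begin

lemma diam_attained_and_bound:
  assumes "finite S" "S \<noteq> {}"
  shows "\<exists>x\<in>S. \<exists>y\<in>S. d x y = diam d S" and "\<lbrakk>x \<in> S; y \<in> S\<rbrakk> \<Longrightarrow> d x y \<le> diam d S"
proof -
  have eq: "{d x y | x y. x \<in> S \<and> y \<in> S} = (\<lambda>(x, y). d x y) ` (S \<times> S)" by auto
  have fin: "finite {d x y | x y. x \<in> S \<and> y \<in> S}"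
    unfolding eq using assms(1) by blast
  have "diam d S \<in> {d x y | x y. x \<in> S \<and> y \<in> S}"
    unfolding diam_def by (rule Max_in[OF fin]) (use assms(2) in auto)
  then obtain a b where "diam d S = d a b" "a \<in> S" "b \<in> S" by blast
  then show "\<exists>x\<in>S. \<exists>y\<in>S. d x y = diam d S"
    by (intro bexI[of _ a] bexI[of _ b]) simp_all
  show "d x y \<le> diam d S" if "x \<in> S" "y \<in> S"
    unfolding diam_def by (rule Max_ge[OF fin]) (use that in auto)
qed

lemma diam_singleton: "x \<in> M \<Longrightarrow> diam d {x} = 0"
  by (simp add: diam_def)

lemma ex1_diametrical_parts:
  assumes "finite S" "S \<subseteq> M" "2 \<le> card S"
  shows "\<exists>!P. complete_multipartite (diametrical_graph d S) P"
proof -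
  define R where "R = {(u, v). u \<in> S \<and> v \<in> S \<and> d u v < diam d S}"
  have "S \<noteq> {}" using assms(3) by auto
  note dm = diam_attained_and_bound[OF assms(1) \<open>S \<noteq> {}\<close>]
  obtain a b where ab: "a \<in> S" "b \<in> S" "a \<noteq> b"
    using assms(3) by (metis card_le_Suc0_iff_eq assms(1) not_less_eq_eq numeral_2_eq_2)
  have pos: "0 < diam d S"
    using dm(2)[OF ab(1,2)] ab assms(2) mdist_pos_less[of a b] by fastforce
  have eqv: "equiv S R"
  proof (rule equivI)
    show "R \<subseteq> S \<times> S" by (auto simp: R_def)
    show "refl_on S R" using pos assms(2) by (auto simp: R_def refl_on_def)
    show "sym R" by (auto simp: R_def sym_def commute)
    show "trans R"
    proof (rule transI)
      fix x y z assume "(x, y) \<in> R" "(y, z) \<in> R"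
      then have xyz: "x \<in> S" "y \<in> S" "z \<in> S"
        and lt: "d x y < diam d S" "d y z < diam d S"
        by (auto simp: R_def)
      have "d x z \<le> max (d x y) (d y z)"
        using xyz assms(2) by (intro ultrametric) auto
      with lt have "d x z < diam d S" by linarith
      with xyz show "(x, z) \<in> R" by (simp add: R_def)
    qed
  qed
  have arcs: "parcs (diametrical_graph d S) =
      {(u, v). \<exists>A\<in>S // R. \<exists>B\<in>S // R. A \<noteq> B \<and> u \<in> A \<and> v \<in> B}" (is "?L = ?R")
  proof -
    have L: "(u, v) \<in> ?L \<longleftrightarrow> u \<in> S \<and> v \<in> S \<and> (u, v) \<notin> R" for u v
      using dm(2)[of u v] by (auto simp: diametrical_graph_def R_def)
    have R: "(u, v) \<in> ?R \<longleftrightarrow> u \<in> S \<and> v \<in> S \<and> (u, v) \<notin> R" for u v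
    proof
      assume "(u, v) \<in> ?R"
      then obtain A B where "A \<in> S // R" "B \<in> S // R" "A \<noteq> B" "u \<in> A" "v \<in> B" by auto
      then show "u \<in> S \<and> v \<in> S \<and> (u, v) \<notin> R"
        using quotient_eqI[OF eqv] in_quotient_imp_subset[OF eqv] by blast
    next
      assume uv: "u \<in> S \<and> v \<in> S \<and> (u, v) \<notin> R"
      then have "R `` {u} \<in> S // R" "R `` {v} \<in> S // R" "u \<in> R `` {u}" "v \<in> R `` {v}"
        using equiv_class_self[OF eqv] by (auto intro: quotientI)
      moreover have "R `` {u} \<noteq> R `` {v}"
        using uv eq_equiv_class[OF _ eqv] by blast
      ultimately show "(u, v) \<in> ?R"
        unfolding mem_Collect_eq prod.case by (intro bexI conjI)
    qed
    show ?thesis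
      by (rule equalityI; rule subrelI; simp only: L R simp_thms)
  qed
  have "2 \<le> card (S // R)"
  proof -
    obtain x y where "x \<in> S" "y \<in> S" "d x y = diam d S" using dm(1) by blast
    then have "(x, y) \<in> parcs (diametrical_graph d S)"
      by (simp add: diametrical_graph_def)
    then obtain A B where "A \<in> S // R" "B \<in> S // R" "A \<noteq> B" unfolding arcs by auto
    moreover have "finite (S // R)"
      using eqv assms(1) by (meson equiv_type finite_quotient)
    ultimately show ?thesis
      using card_mono[of "S // R" "{A, B}"] by auto
  qed
  then have "complete_multipartite (diametrical_graph d S) (S // R)"
    using partition_on_quotient[OF eqv] arcs
    by (simp add: complete_multipartite_def diametrical_graph_def)
  then show ?thesis using complete_multipartite_unique by blast
qed

end

end

theory Submission
  imports Defs
begin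

text \<open>
  An isometry of \<open>X\<close> onto itself permutes the nodes of each level, and the nodes of one level
  partition a subset of \<open>X\<close>. Hence, if \<open>X\<close> is homogeneous, extending the one-point map
  \<open>a \<mapsto> b\<close> carries the level-\<open>n\<close> node of \<open>a\<close> onto that of \<open>b\<close>.
  Conversely, it suffices to extend a partial isometry \<open>f\<close> by one point \<open>p\<close>. Descend the tree
  along the nodes containing \<open>p\<close> as long as they meet the domain; when the child containing
  \<open>p\<close> no longer does, the equal numbers of children leave a child of the corresponding target
  node that misses the range of \<open>f\<close>, and any point of it is a valid image of \<open>p\<close>.
\<close>

section \<open>Preliminaries on isometries and child counts\<close>

lemma diam_isometry_image:
  assumes "isometry_on d S g"
  shows "diam d (g ` S) = diam d S"
proof -
  have eq: "{d x y |x y. x \<in> T \<and> y \<in> T} = (\<lambda>(x, y). d x y) ` (T \<times> T)" for T by auto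
  have "(\<lambda>(x, y). d x y) ` (g ` S \<times> g ` S) = (\<lambda>(x, y). d (g x) (g y)) ` (S \<times> S)"
    by (force simp: image_def)
  also have "\<dots> = (\<lambda>(x, y). d x y) ` (S \<times> S)"
    by (rule image_cong) (use assms in \<open>auto simp: isometry_on_def\<close>)
  finally show ?thesis by (simp add: diam_def eq)
qed

lemma isometry_on_subset: "isometry_on d B f \<Longrightarrow> A \<subseteq> B \<Longrightarrow> isometry_on d A f"
  unfolding isometry_on_def by blast

text \<open>The out-degree counts arcs; those leaving \<open>S\<close> are the images of its parts
  under the injective map \<open>Pair S\<close>. The case split is essential: for a singleton,
  \<open>diametrical_parts\<close> is an unspecified \<open>THE\<close> value.\<close>

lemma num_children_representing_tree:
  assumes "S \<in> representing_nodes d X"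
  shows "num_children (representing_tree d X) S =
    (if 2 \<le> card S then card (diametrical_parts d S) else 0)"
proof -
  have "out_arcs (with_proj (representing_tree d X)) S =
      (if 2 \<le> card S then Pair S ` diametrical_parts d S else {})"
    using assms by (auto simp: out_arcs_def representing_tree_def with_proj_def)
  then show ?thesis
    by (simp add: num_children_def out_degree_def card_image inj_on_def)
qed

section \<open>Diametrical parts as open balls\<close>

context Ultrametric_space
begin

lemma complete_multipartite_diametrical_parts:
  assumes "finite S" "S \<subseteq> M" "2 \<le> card S"
  shows "complete_multipartite (diametrical_graph d S) (diametrical_parts d S)"
  unfolding diametrical_parts_def by (rule theI'[OF ex1_diametrical_parts[OF assms]])

lemma partition_on_diametrical_parts:
  assumes "finite S" "S \<subseteq> M" "2 \<le> card S"
  shows "partition_on S (diametrical_parts d S)"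
  using complete_multipartite_diametrical_parts[OF assms]
  by (simp add: complete_multipartite_def diametrical_graph_def)

text \<open>In a complete multipartite graph the part of \<open>u\<close> consists of the vertices
  not adjacent to \<open>u\<close>. As no distance in \<open>S\<close> exceeds the diameter,
  non-adjacency means a strictly smaller distance, so parts are open balls in \<open>S\<close> of
  radius \<open>diam d S\<close> around any of their points.\<close>

lemma diametrical_part_eq:
  assumes "finite S" "S \<subseteq> M" "2 \<le> card S" "C \<in> diametrical_parts d S" "u \<in> C"
  shows "C = {v \<in> S. d u v < diam d S}"
proof -
  have "C \<subseteq> S"
    using partition_on_diametrical_parts[OF assms(1-3)] assms(4) by (auto simp: partition_on_def)
  with assms(5) have "u \<in> S" by blast
  then have "d u v \<le> diam d S" if "v \<in> S" for v
    using that diam_attained_and_bound(2)[OF assms(1)] by blast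
  then show ?thesis
    using complete_multipartite_part_eq[OF complete_multipartite_diametrical_parts[OF assms(1-3)]
        assms(4,5)] \<open>u \<in> S\<close>
    by (fastforce simp: diametrical_graph_def)
qed

lemma diametrical_parts_eq:
  assumes "finite S" "S \<subseteq> M" "2 \<le> card S"
  shows "diametrical_parts d S = (\<lambda>u. {v \<in> S. d u v < diam d S}) ` S"
proof -
  note po = partition_on_diametrical_parts[OF assms]
  note eq = diametrical_part_eq[OF assms]
  show ?thesis
  proof (intro equalityI subsetI)
    fix C assume C: "C \<in> diametrical_parts d S"
    then have "C \<noteq> {}" "C \<subseteq> S" using po by (auto simp: partition_on_def)
    then obtain u where "u \<in> C" "u \<in> S" by blast
    then show "C \<in> (\<lambda>u. {v \<in> S. d u v < diam d S}) ` S" using eq[OF C] by blast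
  next
    fix C assume "C \<in> (\<lambda>u. {v \<in> S. d u v < diam d S}) ` S"
    then obtain u where u: "u \<in> S" "C = {v \<in> S. d u v < diam d S}" by blast
    moreover from u(1) obtain D where "D \<in> diametrical_parts d S" "u \<in> D"
      using po by (auto simp: partition_on_def)
    ultimately show "C \<in> diametrical_parts d S" using eq by metis
  qed
qed

text \<open>A pair of points realising the diameter cannot lie in one part. The strict inclusion
  lets cardinality decrease along the tree and makes path lengths unique.\<close>

lemma diametrical_part_psubset:
  assumes "finite S" "S \<subseteq> M" "2 \<le> card S" "C \<in> diametrical_parts d S"
  shows "C \<subset> S" "C \<noteq> {}"
proof -
  note po = partition_on_diametrical_parts[OF assms(1-3)]
  show ne: "C \<noteq> {}" using po assms(4) by (auto simp: partition_on_def)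
  have sub: "C \<subseteq> S" using po assms(4) by (auto simp: partition_on_def)
  obtain x y where xy: "x \<in> S" "y \<in> S" "d x y = diam d S"
    using diam_attained_and_bound(1)[OF assms(1)] ne sub by blast
  have "C \<noteq> S"
    using diametrical_part_eq[OF assms, of x] xy by force
  with sub show "C \<subset> S" by blast
qed

lemma mem_diametrical_part_iff:
  assumes "finite S" "S \<subseteq> M" "2 \<le> card S" "C \<in> diametrical_parts d S" "u \<in> C" "v \<in> S"
  shows "v \<in> C \<longleftrightarrow> d u v < diam d S"
  using assms(6) by (subst diametrical_part_eq[OF assms(1-5)]) simp

lemma dist_outside_diametrical_part:
  assumes "finite S" "S \<subseteq> M" "2 \<le> card S" "C \<in> diametrical_parts d S" "u \<in> C"
    "v \<in> S" "v \<notin> C"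
  shows "d u v = diam d S"
proof -
  have "u \<in> S" using diametrical_part_psubset(1)[OF assms(1-4)] assms(5) by blast
  then have "d u v \<le> diam d S"
    using diam_attained_and_bound(2)[OF assms(1)] assms(6) by blast
  with mem_diametrical_part_iff[OF assms(1-6)] assms(7) show ?thesis by simp
qed

lemma ex_diametrical_part_avoiding_image:
  assumes S: "finite S" "S \<subseteq> M" "2 \<le> card S"
    and S': "finite S'" "S' \<subseteq> M" "2 \<le> card S'"
    and diam_eq: "diam d S = diam d S'"
    and card_eq: "card (diametrical_parts d S) = card (diametrical_parts d S')"
    and A: "A \<subseteq> S" "f ` A \<subseteq> S'" "isometry_on d A f"
    and C: "C \<in> diametrical_parts d S" "A \<inter> C = {}"
  shows "\<exists>D\<in>diametrical_parts d S'. f ` A \<inter> D = {}"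
proof (rule ccontr)
  assume "\<not> ?thesis"
  then have "\<forall>D\<in>diametrical_parts d S'. \<exists>a. a \<in> A \<and> f a \<in> D" by blast
  \<comment> \<open>\<open>h\<close> picks for each target part a point of \<open>A\<close> that
    \<open>f\<close> sends into it; \<open>k\<close> below gives the source part containing that
    point.\<close>
  then obtain h where "\<forall>D\<in>diametrical_parts d S'. h D \<in> A \<and> f (h D) \<in> D"
    by (rule bchoice[THEN exE])
  then have h: "h D \<in> A" "f (h D) \<in> D" if "D \<in> diametrical_parts d S'" for D
    using that by blast+
  have hS: "h D \<in> S" "f (h D) \<in> S'" if "D \<in> diametrical_parts d S'" for D
    using h(1)[OF that] A(1,2) by blast+
  note po = partition_on_diametrical_parts[OF S]
  have "\<exists>B. B \<in> diametrical_parts d S \<and> h D \<in> B" if "D \<in> diametrical_parts d S'" for D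
    using hS(1)[OF that] unfolding Union_iff[symmetric] Bex_def[symmetric]
      partition_onD1[OF po, symmetric] .
  then have "\<forall>D\<in>diametrical_parts d S'. \<exists>B. B \<in> diametrical_parts d S \<and> h D \<in> B" ..
  then obtain k where "\<forall>D\<in>diametrical_parts d S'. k D \<in> diametrical_parts d S \<and> h D \<in> k D"
    by (rule bchoice[THEN exE])
  then have k: "k D \<in> diametrical_parts d S" "h D \<in> k D" if "D \<in> diametrical_parts d S'" for D
    using that by blast+
  \<comment> \<open>Two chosen points in a common source part are closer than the common diameter,
    hence so are their images, which therefore share a target part.\<close>
  have inj: "inj_on k (diametrical_parts d S')"
  proof (rule inj_onI)
    fix D E assume D: "D \<in> diametrical_parts d S'" and E: "E \<in> diametrical_parts d S'"
      and eq: "k D = k E"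
    have "h E \<in> k D" unfolding eq by (rule k(2)[OF E])
    then have "d (h D) (h E) < diam d S"
      using mem_diametrical_part_iff[OF S k[OF D] hS(1)[OF E]] by blast
    moreover have "d (f (h D)) (f (h E)) = d (h D) (h E)"
      using A(3) h(1)[OF D] h(1)[OF E] unfolding isometry_on_def by blast
    ultimately have "d (f (h D)) (f (h E)) < diam d S'" by (simp only: diam_eq)
    then have "f (h E) \<in> D"
      using mem_diametrical_part_iff[OF S' D h(2)[OF D] hS(2)[OF E]] by blast
    then have "D \<inter> E \<noteq> {}" using h(2)[OF E] by blast
    with disjointD[OF partition_onD2[OF partition_on_diametrical_parts[OF S']] D E]
    show "D = E" by blast
  qed
  have fin: "finite (diametrical_parts d S)" by (rule finite_elements[OF S(1) po])
  have "k ` diametrical_parts d S' \<subseteq> diametrical_parts d S - {C}"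
    using k h(1) C(2) by blast
  then have "card (diametrical_parts d S') \<le> card (diametrical_parts d S - {C})"
    by (rule card_inj_on_le[OF inj]) (use fin in simp)
  also have "\<dots> < card (diametrical_parts d S)"
    by (rule card_Diff1_less[OF fin C(1)])
  finally show False using card_eq by simp
qed

lemma inj_on_isometry:
  assumes "isometry_on d S g" "S \<subseteq> M" "g ` S \<subseteq> M"
  shows "inj_on g S"
proof (rule inj_onI)
  fix x y assume xy: "x \<in> S" "y \<in> S" "g x = g y"
  have "d x y = d (g x) (g y)" using assms(1) xy(1,2) unfolding isometry_on_def by metis
  also have "\<dots> = 0" using xy(2,3) assms(3) by auto
  finally show "x = y" using xy(1,2) assms(2) zero by blast
qed

text \<open>The parts are open balls whose radius is the diameter; an isometry keeps the diameter
  and carries balls to balls.\<close>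

lemma diametrical_parts_isometry_image:
  assumes "finite S" "S \<subseteq> M" "2 \<le> card S" "isometry_on d S g" "g ` S \<subseteq> M"
  shows "diametrical_parts d (g ` S) = (`) g ` diametrical_parts d S"
proof -
  have "card (g ` S) = card S" using inj_on_isometry[OF assms(4,2,5)] by (rule card_image)
  then have "diametrical_parts d (g ` S) = (\<lambda>u. {v \<in> g ` S. d u v < diam d S}) ` g ` S"
    using assms by (subst diametrical_parts_eq) (auto simp: diam_isometry_image)
  also have "\<dots> = (\<lambda>u. g ` {v \<in> S. d u v < diam d S}) ` S"
    unfolding image_image
    by (rule image_cong) (use assms(4) in \<open>auto simp: isometry_on_def\<close>)
  also have "\<dots> = (`) g ` diametrical_parts d S"
    using assms(1-3) by (simp add: diametrical_parts_eq image_image)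
  finally show ?thesis .
qed

end

section \<open>Nodes, paths and levels of the representing tree\<close>

locale finite_ultrametric_space = Ultrametric_space +
  assumes finite_space: "finite M" and nonempty_space: "M \<noteq> {}"
begin

abbreviation tree_arcs :: "('a set \<times> 'a set) set" where
  "tree_arcs \<equiv> parcs (representing_tree d M)"

lemma representing_nodes_subset:
  "S \<in> representing_nodes d M \<Longrightarrow> S \<subseteq> M \<and> S \<noteq> {} \<and> finite S"
proof (induction rule: representing_nodes.induct)
  case root
  show ?case using finite_space nonempty_space by simp
next
  case (child S C)
  then have S: "S \<subseteq> M" "finite S" by blast+
  have "C \<subset> S" "C \<noteq> {}"
    by (rule diametrical_part_psubset[OF S(2,1) child.hyps(2,3)])+
  with S show ?case by (auto intro: finite_subset)
qed

lemma tree_arcs_iff: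
  "(S, C) \<in> tree_arcs \<longleftrightarrow>
    S \<in> representing_nodes d M \<and> 2 \<le> card S \<and> C \<in> diametrical_parts d S"
  by (simp add: representing_tree_def)

lemma relpow_tree_arcs_node: "(M, S) \<in> tree_arcs ^^ n \<Longrightarrow> S \<in> representing_nodes d M"
  by (cases n) (auto simp: tree_arcs_iff representing_nodes.root dest: representing_nodes.child)

text \<open>This guarantees that the \<open>LEAST\<close> in \<open>level\<close> ranges over a
  nonempty set of path lengths.\<close>

lemma representing_node_relpow:
  "S \<in> representing_nodes d M \<Longrightarrow> \<exists>n. (M, S) \<in> tree_arcs ^^ n"
proof (induction rule: representing_nodes.induct)
  case root
  show ?case by (rule exI[of _ 0]) simp
next
  case (child S C)
  then obtain n where "(M, S) \<in> tree_arcs ^^ n" by blast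
  moreover have "(S, C) \<in> tree_arcs" using child by (simp add: tree_arcs_iff)
  ultimately have "(M, C) \<in> tree_arcs ^^ Suc n" by auto
  then show ?case by blast
qed

lemma relpow_level:
  "S \<in> representing_nodes d M \<Longrightarrow> (M, S) \<in> tree_arcs ^^ level (representing_tree d M) M S"
  unfolding level_def by (rule LeastI_ex[OF representing_node_relpow])

text \<open>The parents of the two nodes also contain \<open>u\<close>, so they agree by induction;
  both nodes are then the same open ball around \<open>u\<close> in that parent. Depth is measured
  by path length here; \<open>level_eqI\<close> links it to \<open>level\<close>.\<close>

lemma same_level_nodes_eq:
  "(M, S) \<in> tree_arcs ^^ n \<Longrightarrow> (M, S') \<in> tree_arcs ^^ n \<Longrightarrow> u \<in> S \<Longrightarrow> u \<in> S' \<Longrightarrow> S = S'"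
proof (induction n arbitrary: S S')
  case 0
  then show ?case by simp
next
  case (Suc n)
  obtain R where R: "(M, R) \<in> tree_arcs ^^ n" "(R, S) \<in> tree_arcs" using Suc.prems(1) by auto
  obtain R' where R': "(M, R') \<in> tree_arcs ^^ n" "(R', S') \<in> tree_arcs"
    using Suc.prems(2) by auto
  have RM: "R \<subseteq> M \<and> finite R" "R' \<subseteq> M \<and> finite R'"
    using R R' by (auto simp: tree_arcs_iff dest: representing_nodes_subset)
  have u: "u \<in> R" "u \<in> R'"
    using R(2) R'(2) RM Suc.prems(3,4) diametrical_part_psubset(1) by (meson psubsetD tree_arcs_iff)+
  have eq: "R = R'" by (rule Suc.IH[OF R(1) R'(1) u])
  have "S = {v \<in> R. d u v < diam d R}"
    by (rule diametrical_part_eq) (use R(2) RM Suc.prems(3) in \<open>simp_all add: tree_arcs_iff\<close>)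
  moreover have "S' = {v \<in> R'. d u v < diam d R'}"
    by (rule diametrical_part_eq) (use R'(2) RM Suc.prems(4) in \<open>simp_all add: tree_arcs_iff\<close>)
  ultimately show ?case using eq by simp
qed

lemma relpow_tree_arcs_psubset:
  "(R, S) \<in> tree_arcs ^^ Suc k \<Longrightarrow> S \<subset> R"
proof (induction k arbitrary: S)
  case 0
  then show ?case
    using diametrical_part_psubset(1)[of R S] representing_nodes_subset[of R]
    by (simp add: tree_arcs_iff)
next
  case (Suc k)
  then obtain Q where Q: "(R, Q) \<in> tree_arcs ^^ Suc k" "(Q, S) \<in> tree_arcs"
    by (meson relpow_Suc_E)
  then have "S \<subset> Q"
    using diametrical_part_psubset(1)[of Q S] representing_nodes_subset[of Q]
    by (simp add: tree_arcs_iff)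
  with Suc.IH[OF Q(1)] show ?case by blast
qed

text \<open>If a path of length \<open>m < n\<close> also led to \<open>S\<close>, the given path
  would pass at depth \<open>m\<close> through some \<open>R\<close> strictly containing
  \<open>S\<close>. Nodes of equal depth that share a point are equal, a contradiction.\<close>

lemma level_eqI:
  assumes "(M, S) \<in> tree_arcs ^^ n"
  shows "level (representing_tree d M) M S = n"
proof -
  have node: "S \<in> representing_nodes d M" using assms by (rule relpow_tree_arcs_node)
  define m where "m = level (representing_tree d M) M S"
  have m: "(M, S) \<in> tree_arcs ^^ m" unfolding m_def by (rule relpow_level[OF node])
  have "m \<le> n" unfolding m_def level_def using assms by (rule Least_le)
  moreover have "\<not> m < n"
  proof
    assume "m < n"
    then obtain k where "n = m + Suc k" using less_imp_Suc_add by fastforce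
    then obtain R where R: "(M, R) \<in> tree_arcs ^^ m" "(R, S) \<in> tree_arcs ^^ Suc k"
      using assms by (metis relcompE prod.inject relpow_add)
    have "S \<subset> R" by (rule relpow_tree_arcs_psubset[OF R(2)])
    moreover obtain u where "u \<in> S" using representing_nodes_subset[OF node] by blast
    ultimately show False using same_level_nodes_eq[OF m R(1)] by blast
  qed
  ultimately show ?thesis unfolding m_def by linarith
qed

lemma level_child:
  assumes "S \<in> representing_nodes d M" "2 \<le> card S" "C \<in> diametrical_parts d S"
  shows "level (representing_tree d M) M C = Suc (level (representing_tree d M) M S)"
  by (rule level_eqI) (use relpow_level[OF assms(1)] assms in \<open>auto simp: tree_arcs_iff\<close>)

text \<open>A singleton has diameter 0, so the two cases of \<open>node_label\<close> merge and
  isometries can be applied to labels directly.\<close>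

lemma node_label_eq_diam:
  assumes "S \<in> representing_nodes d M"
  shows "node_label d S = diam d S"
  using representing_nodes_subset[OF assms] diam_singleton
  by (auto simp: node_label_def card_1_singleton_iff)

section \<open>From homogeneity to equal labels and child counts\<close>

lemma relpow_isometry_image:
  assumes "isometry_on d M g" "g ` M = M"
  shows "(M, S) \<in> tree_arcs ^^ n \<Longrightarrow> (M, g ` S) \<in> tree_arcs ^^ n"
proof (induction n arbitrary: S)
  case 0
  then show ?case using assms(2) by simp
next
  case (Suc n)
  then obtain R where R: "(M, R) \<in> tree_arcs ^^ n" "(R, S) \<in> tree_arcs" by auto
  have RM: "R \<subseteq> M" "finite R" "2 \<le> card R" "S \<in> diametrical_parts d R"
    using R(2) by (auto simp: tree_arcs_iff dest: representing_nodes_subset)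
  have gR: "g ` R \<subseteq> M" "isometry_on d R g"
    using RM(1) assms isometry_on_subset by blast+
  have "card (g ` R) = card R" using inj_on_isometry[OF gR(2) RM(1) gR(1)] by (rule card_image)
  then have "(g ` R, g ` S) \<in> tree_arcs"
    using relpow_tree_arcs_node[OF Suc.IH[OF R(1)]] RM gR
    by (simp add: tree_arcs_iff diametrical_parts_isometry_image)
  with Suc.IH[OF R(1)] show ?case by auto
qed

lemma homogeneous_imp_same_level:
  assumes hom: "homogeneous_space M d"
    and nodes: "S \<in> representing_nodes d M" "S' \<in> representing_nodes d M"
    and lev: "level (representing_tree d M) M S = level (representing_tree d M) M S'"
  shows "node_label d S = node_label d S'"
    and "num_children (representing_tree d M) S = num_children (representing_tree d M) S'"
proof -
  have SM: "S \<subseteq> M" "finite S" using representing_nodes_subset[OF nodes(1)] by auto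
  obtain a b where ab: "a \<in> S" "b \<in> S'" "b \<in> M"
    using representing_nodes_subset[OF nodes(1)] representing_nodes_subset[OF nodes(2)] by blast
  have aM: "a \<in> M" using ab(1) SM(1) by (rule rev_subsetD)
  have iso_ab: "isometry_on d {a} (\<lambda>_. b)" using aM ab(3) by (simp add: isometry_on_def)
  have "\<exists>g. isometry_on d M g \<and> g ` M = M \<and> (\<forall>x\<in>{a}. g x = b)"
    by (rule hom[unfolded homogeneous_space_def, THEN spec, THEN spec, THEN mp])
      (use iso_ab aM ab(3) in simp)
  then obtain g where g: "isometry_on d M g" "g ` M = M" "g a = b" by blast
  have "b \<in> g ` S" unfolding g(3)[symmetric] using ab(1) by (rule imageI)
  moreover have "(M, g ` S) \<in> tree_arcs ^^ level (representing_tree d M) M S'"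
    using relpow_isometry_image[OF g(1,2) relpow_level[OF nodes(1)]] by (simp only: lev)
  ultimately have S': "S' = g ` S"
    using same_level_nodes_eq[OF relpow_level[OF nodes(2)]] ab(2) by blast
  have iso: "isometry_on d S g" by (rule isometry_on_subset[OF g(1) SM(1)])
  have gS: "g ` S \<subseteq> M" using image_mono[OF SM(1), of g] unfolding g(2) .
  have inj: "inj_on g S" by (rule inj_on_isometry[OF iso SM(1) gS])
  show "node_label d S = node_label d S'"
    using nodes iso by (simp add: node_label_eq_diam diam_isometry_image S')
  have "card (diametrical_parts d (g ` S)) = card (diametrical_parts d S)" if "2 \<le> card S"
  proof -
    have "diametrical_parts d S \<subseteq> Pow S"
      using diametrical_part_psubset(1)[OF SM(2,1) that] by blast
    \<comment> \<open>Injectivity of \<open>g\<close> on points passes to subsets of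
      \<open>S\<close>, so distinct parts keep distinct images and their number is
      preserved.\<close>
    then have "inj_on ((`) g) (diametrical_parts d S)"
      using inj_on_image_Pow[OF inj] inj_on_subset by blast
    then show ?thesis
      using SM iso gS that by (simp add: diametrical_parts_isometry_image card_image)
  qed
  then show "num_children (representing_tree d M) S = num_children (representing_tree d M) S'"
    using nodes by (simp add: num_children_representing_tree S' card_image[OF inj])
qed

section \<open>From equal labels and child counts to homogeneity\<close>

lemma one_point_extension_nodes:
  assumes label: "\<And>S S'. \<lbrakk>S \<in> representing_nodes d M; S' \<in> representing_nodes d M;
        level (representing_tree d M) M S = level (representing_tree d M) M S'\<rbrakk>
      \<Longrightarrow> node_label d S = node_label d S'"
    and children: "\<And>S S'. \<lbrakk>S \<in> representing_nodes d M; S' \<in> representing_nodes d M;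
        level (representing_tree d M) M S = level (representing_tree d M) M S'\<rbrakk>
      \<Longrightarrow> num_children (representing_tree d M) S = num_children (representing_tree d M) S'"
  shows "\<lbrakk>S \<in> representing_nodes d M; S' \<in> representing_nodes d M;
      level (representing_tree d M) M S = level (representing_tree d M) M S';
      A \<subseteq> S; f ` A \<subseteq> S'; isometry_on d A f; p \<in> S\<rbrakk>
    \<Longrightarrow> \<exists>q\<in>S'. \<forall>a\<in>A. d q (f a) = d p a"
\<comment> \<open>The nodes and the domain vary because the descent replaces \<open>S\<close>,
  \<open>S'\<close> by children and \<open>A\<close> by its trace on a child; \<open>f\<close> and
  \<open>p\<close> stay fixed.\<close>
proof (induction "card S" arbitrary: S S' A rule: less_induct)
  case less
  note nS = less.prems(1) and nS' = less.prems(2) and lev = less.prems(3)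
  have S: "finite S" "S \<subseteq> M" and S': "finite S'" "S' \<subseteq> M" "S' \<noteq> {}"
    using representing_nodes_subset[OF nS] representing_nodes_subset[OF nS'] by simp_all
  have iso: "d (f a) (f b) = d a b" if "a \<in> A" "b \<in> A" for a b
    using less.prems(6) that by (simp add: isometry_on_def)
  show ?case
  proof (cases "2 \<le> card S")
    case False
    \<comment> \<open>At a leaf \<open>S\<close> is just \<open>p\<close>: either \<open>A\<close>
      is empty and any point of \<open>S'\<close> serves, or \<open>A\<close> is the singleton of
      \<open>p\<close> and \<open>f p\<close> serves.\<close>
    then have "card S \<le> Suc 0" by simp
    then have "S \<subseteq> {p}" using card_le_Suc0_iff_eq[OF S(1)] less.prems(7) by blast
    with less.prems(4) have "A \<subseteq> {p}" by (rule subset_trans)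
    then have A: "A = {} \<or> A = {p}" by (simp only: subset_singleton_iff)
    show ?thesis
    proof (cases "A = {}")
      case True
      with S'(3) show ?thesis by blast
    next
      case False
      with A have "A = {p}" by blast
      then show ?thesis using less.prems(5) iso[of p p] by (intro bexI[of _ "f p"]) simp_all
    qed
  next
    case cS: True
    have nchild: "num_children (representing_tree d M) S = num_children (representing_tree d M) S'"
      by (rule children[OF nS nS' lev])
    have "2 \<le> card (diametrical_parts d S)"
      using complete_multipartite_diametrical_parts[OF S cS] by (simp add: complete_multipartite_def)
    \<comment> \<open>A leaf has no children while \<open>S\<close> has at least two, so
      \<open>S'\<close> cannot be a leaf.\<close>
    with nchild cS have cS': "2 \<le> card S'"
      using nS nS' by (auto simp: num_children_representing_tree split: if_splits)
    have card_eq: "card (diametrical_parts d S) = card (diametrical_parts d S')"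
      using nchild cS cS' nS nS' by (simp add: num_children_representing_tree)
    have diam_eq: "diam d S = diam d S'"
      using label[OF nS nS' lev] nS nS' by (simp add: node_label_eq_diam)
    note po = partition_on_diametrical_parts[OF S cS]
    note po' = partition_on_diametrical_parts[OF S'(1,2) cS']
    note part = mem_diametrical_part_iff[OF S cS]
    note part' = mem_diametrical_part_iff[OF S'(1,2) cS']
    note outside = dist_outside_diametrical_part[OF S cS]
    note outside' = dist_outside_diametrical_part[OF S'(1,2) cS']
    have AS: "a \<in> S" "f a \<in> S'" if "a \<in> A" for a
      using that less.prems(4,5) by blast+
    obtain C where C: "C \<in> diametrical_parts d S" "p \<in> C"
      using po less.prems(7) by (auto simp: partition_on_def)
    show ?thesis
    proof (cases "A \<inter> C = {}")
      case True
      \<comment> \<open>All of \<open>A\<close> lies outside the part of \<open>p\<close>, so every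
        prescribed distance is the diameter. Any point of a target part missing the range has
        exactly these distances.\<close>
      obtain D where D: "D \<in> diametrical_parts d S'" "f ` A \<inter> D = {}"
        using ex_diametrical_part_avoiding_image[OF S cS S'(1,2) cS' diam_eq card_eq
            less.prems(4,5,6) C(1) True] by blast
      then obtain q where q: "q \<in> D" "q \<in> S'"
        using diametrical_part_psubset[OF S'(1,2) cS' D(1)] by blast
      have "d q (f a) = d p a" if a: "a \<in> A" for a
      proof -
        have "a \<notin> C" "f a \<notin> D" using a True D(2) by blast+
        then show ?thesis
          using outside[OF C AS(1)[OF a]] outside'[OF D(1) q(1) AS(2)[OF a]] diam_eq by simp
      qed
      with q(2) show ?thesis by blast
    next
      case False
      then obtain c where c: "c \<in> A" "c \<in> C" by blast
      then have "f c \<in> S'" using less.prems(5) by blast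
      then obtain D where D: "D \<in> diametrical_parts d S'" "f c \<in> D"
        using po' by (auto simp: partition_on_def)
      \<comment> \<open>Membership in either part is a distance bound from \<open>c\<close> or from
        \<open>f c\<close>, with the same radius, so \<open>f\<close> respects it.\<close>
      have same: "a \<in> C \<longleftrightarrow> f a \<in> D" if "a \<in> A" for a
      proof -
        have "a \<in> C \<longleftrightarrow> d c a < diam d S"
          by (rule part[OF C(1) c(2) AS(1)[OF that]])
        also have "\<dots> \<longleftrightarrow> d (f c) (f a) < diam d S'"
          using iso[OF c(1) that] diam_eq by simp
        also have "\<dots> \<longleftrightarrow> f a \<in> D"
          by (rule part'[OF D AS(2)[OF that], symmetric])
        finally show ?thesis .
      qed
      have CS: "C \<subset> S" by (rule diametrical_part_psubset(1)[OF S cS C(1)])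
      have DS': "D \<subset> S'" by (rule diametrical_part_psubset(1)[OF S'(1,2) cS' D(1)])
      \<comment> \<open>Only the points of \<open>A\<close> inside \<open>C\<close> constrain the
        choice within \<open>D\<close>: for the others both distances equal the common
        diameter.\<close>
      have "\<exists>q\<in>D. \<forall>a\<in>A \<inter> C. d q (f a) = d p a"
      proof (rule less.hyps[of C])
        show "card C < card S" by (rule psubset_card_mono[OF S(1) CS])
        show "C \<in> representing_nodes d M" "D \<in> representing_nodes d M"
          by (rule representing_nodes.child[OF nS cS C(1)])
            (rule representing_nodes.child[OF nS' cS' D(1)])
        show "level (representing_tree d M) M C = level (representing_tree d M) M D"
          using level_child[OF nS cS C(1)] level_child[OF nS' cS' D(1)] lev by simp
        show "A \<inter> C \<subseteq> C" by blast
        show "f ` (A \<inter> C) \<subseteq> D" using same by blast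
        show "isometry_on d (A \<inter> C) f" by (rule isometry_on_subset[OF less.prems(6)]) blast
        show "p \<in> C" by (rule C(2))
      qed
      then obtain q where q: "q \<in> D" "\<And>a. a \<in> A \<inter> C \<Longrightarrow> d q (f a) = d p a" by blast
      have "d q (f a) = d p a" if a: "a \<in> A" for a
      proof (cases "a \<in> C")
        case True
        then show ?thesis using q(2) a by blast
      next
        case False
        then have "f a \<notin> D" using same a by blast
        then show ?thesis
          using outside[OF C AS(1)[OF a] False] outside'[OF D(1) q(1) AS(2)[OF a]] diam_eq by simp
      qed
      then show ?thesis using q(1) DS' by blast
    qed
  qed
qed

text \<open>Points are adjoined one at a time until the domain is all of \<open>M\<close>. The
  resulting isometry is an injective self-map of a finite set, hence onto.\<close>

lemma homogeneous_if_one_point_extension: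
  assumes ext: "\<And>A f p. \<lbrakk>A \<subseteq> M; f ` A \<subseteq> M; isometry_on d A f; p \<in> M\<rbrakk>
      \<Longrightarrow> \<exists>q\<in>M. \<forall>a\<in>A. d q (f a) = d p a"
  shows "homogeneous_space M d"
proof -
  have extend: "\<exists>g. isometry_on d (A \<union> B) g \<and> g ` (A \<union> B) \<subseteq> M \<and> (\<forall>x\<in>A. g x = f x)"
    if A: "A \<subseteq> M" "f ` A \<subseteq> M" "isometry_on d A f" and "finite B" "B \<subseteq> M" for A B f
    using \<open>finite B\<close> \<open>B \<subseteq> M\<close>
  proof (induction B)
    case empty
    then show ?case using A by auto
  next
    case (insert p B)
    then obtain g where g: "isometry_on d (A \<union> B) g" "g ` (A \<union> B) \<subseteq> M" "\<forall>x\<in>A. g x = f x"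
      by auto
    show ?case
    \<comment> \<open>A point of \<open>A\<close> already has its value. Otherwise \<open>p\<close>
      lies in neither \<open>A\<close> nor \<open>B\<close>, so the update at \<open>p\<close>
      disturbs no earlier value.\<close>
    proof (cases "p \<in> A")
      case True
      then show ?thesis using g by (auto simp: insert_absorb)
    next
      case False
      obtain q where q: "q \<in> M" "\<forall>a\<in>A \<union> B. d q (g a) = d p a"
        using ext[OF _ g(2,1), of p] A(1) insert.prems by auto
      have pM: "p \<in> M" using insert.prems by blast
      have "isometry_on d (A \<union> insert p B) (g(p := q))"
        using g(1) q pM False insert.hyps(2) unfolding isometry_on_def
        by (auto simp: commute)
      moreover have "(g(p := q)) ` (A \<union> insert p B) \<subseteq> M" using g(2) q(1) by auto
      moreover have "\<forall>x\<in>A. (g(p := q)) x = f x" using g(3) False by auto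
      ultimately show ?thesis by blast
    qed
  qed
  show ?thesis
    unfolding homogeneous_space_def
  proof (intro allI impI, elim conjE)
    fix A f assume A: "A \<subseteq> M" "f ` A \<subseteq> M" "isometry_on d A f"
    obtain g where g: "isometry_on d M g" "g ` M \<subseteq> M" "\<forall>x\<in>A. g x = f x"
      using extend[OF A finite_space subset_refl] A(1) by (auto simp: Un_absorb1)
    have "g ` M = M"
      by (rule endo_inj_surj[OF finite_space g(2) inj_on_isometry[OF g(1) subset_refl g(2)]])
    with g show "\<exists>g. isometry_on d M g \<and> g ` M = M \<and> (\<forall>x\<in>A. g x = f x)" by blast
  qed
qed

end

theorem theorem2p2:
  fixes X :: "'a set" and d :: "'a \<Rightarrow> 'a \<Rightarrow> real"
  assumes "Ultrametric_space X d" and "finite X" and "X \<noteq> {}"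
  shows "homogeneous_space X d \<longleftrightarrow>
    (\<forall>x \<in> pverts (representing_tree d X). \<forall>y \<in> pverts (representing_tree d X).
        x \<noteq> y \<and> level (representing_tree d X) X x = level (representing_tree d X) X y \<longrightarrow>
        node_label d x = node_label d y) \<and>
    (\<forall>x \<in> pverts (representing_tree d X). \<forall>y \<in> pverts (representing_tree d X).
        x \<noteq> y \<and> level (representing_tree d X) X x = level (representing_tree d X) X y \<longrightarrow>
        num_children (representing_tree d X) x = num_children (representing_tree d X) y)"
proof -
  interpret finite_ultrametric_space X d
    using assms by (simp add: finite_ultrametric_space_def finite_ultrametric_space_axioms_def)
  have verts: "pverts (representing_tree d X) = representing_nodes d X"
    by (simp add: representing_tree_def)
  show ?thesis
    unfolding verts
  proof (intro iffI conjI ballI impI; (elim conjE)?)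
    fix x y assume "homogeneous_space X d" "x \<in> representing_nodes d X" "y \<in> representing_nodes d X"
      "level (representing_tree d X) X x = level (representing_tree d X) X y"
    note same = homogeneous_imp_same_level[OF this]
    show "node_label d x = node_label d y" by (rule same)
    show "num_children (representing_tree d X) x = num_children (representing_tree d X) y"
      by (rule same)
  next
    assume *: "\<forall>x\<in>representing_nodes d X. \<forall>y\<in>representing_nodes d X.
        x \<noteq> y \<and> level (representing_tree d X) X x = level (representing_tree d X) X y \<longrightarrow>
        node_label d x = node_label d y"
      "\<forall>x\<in>representing_nodes d X. \<forall>y\<in>representing_nodes d X.
        x \<noteq> y \<and> level (representing_tree d X) X x = level (representing_tree d X) X y \<longrightarrow>
        num_children (representing_tree d X) x = num_children (representing_tree d X) y"
    show "homogeneous_space X d"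
    proof (rule homogeneous_if_one_point_extension)
      fix A f p assume "A \<subseteq> X" "f ` A \<subseteq> X" "isometry_on d A f" "p \<in> X"
      \<comment> \<open>The descent starts with the root paired with itself. The level conditions
        extend to equal nodes by reflexivity, which removes the restriction to different
        ones.\<close>
      then show "\<exists>q\<in>X. \<forall>a\<in>A. d q (f a) = d p a"
        by (intro one_point_extension_nodes[OF _ _ representing_nodes.root representing_nodes.root refl])
          (use * in metis)+
    qed
  qed
qed

end
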